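(* Let $m\ge 1$ and let $p_1,\dots,p_m$ be probability distributions on $\mathrm{U}(1)$, each symmetric and with zero mean. Let $\mathbf{A}=\mathbf{Q}_1\boldsymbol{\Lambda}^{(1)}$ and $\mathbf{B}=\mathbf{Q}_2\boldsymbol{\Lambda}^{(2)}$ be independent random matrices such that, for $i=1,2$, $\mathbf{Q}_i\in\mathbb{C}^{m\times m}$ is a random unitary matrix and, independently of $\mathbf{Q}_i$, $\boldsymbol{\Lambda}^{(i)}=\operatorname{diag}(\Lambda^{(i)}_1,\dots,\Lambda^{(i)}_m)$ is a random diagonal matrix with $\Lambda^{(i)}_j\sim p_j$ for $j=1,\dots,m$; the pairs $(\mathbf{Q}_1,\boldsymbol{\Lambda}^{(1)})$ and $(\mathbf{Q}_2,\boldsymbol{\Lambda}^{(2)})$ are sampled independently of each other. Then $\mathbb{E}\,\operatorname{tr}\big(\mathbf{A}(\mathbf{A}\mathbf{B})^{\dagger}\big)=0$.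
   Context: $\mathrm{U}(1)=\{z\in\mathbb{C}:|z|=1\}$. A distribution $p$ on $\mathrm{U}(1)$ is symmetric if $X\sim p$ implies $-X\sim p$, and has zero mean if $\mathbb{E}[X]=0$ for $X\sim p$. For a complex matrix $\mathbf{M}$, $\mathbf{M}^{\dagger}$ denotes the conjugate transpose, and $\operatorname{tr}$ is the trace. A matrix $\mathbf{Q}\in\mathbb{C}^{m\times m}$ is unitary if $\mathbf{Q}\mathbf{Q}^{\dagger}=\mathbf{I}$. *)

theory Defs
  imports "HOL-Probability.Probability"
begin

definition U1 :: "complex set"
  where "U1 = {z. cmod z = 1}"

definition distribution_on_U1 :: "complex measure \<Rightarrow> bool"
  where "distribution_on_U1 p \<longleftrightarrow> prob_space p \<and> sets p = sets (restrict_space borel U1)"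

text \<open>The law of \<open>X\<close> under the measure \<open>M\<close> is \<open>p\<close>. If \<open>p\<close> is a distribution on the unit
  circle, then measurability into \<open>p\<close> makes \<open>X\<close> take its values in the unit circle.\<close>

definition has_law :: "'w measure \<Rightarrow> ('w \<Rightarrow> 'a) \<Rightarrow> 'a measure \<Rightarrow> bool"
  where "has_law M X p \<longleftrightarrow> X \<in> M \<rightarrow>\<^sub>M p \<and> distr M p X = p"

text \<open>The canonical variable of law \<open>p\<close> is the identity on the probability space \<open>p\<close> itself;
  the next two definitions are stated for it. They depend on the law alone.\<close>

definition symmetric_distribution :: "complex measure \<Rightarrow> bool"
  where "symmetric_distribution p \<longleftrightarrow> has_law p (\<lambda>z. - z) p"

definition zero_mean :: "complex measure \<Rightarrow> bool"
  where "zero_mean p \<longleftrightarrow> integrable p (\<lambda>z. z) \<and> (\<integral>z. z \<partial>p) = 0"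

definition conj_transpose :: "complex^'n^'m \<Rightarrow> complex^'m^'n"
  where "conj_transpose A = (\<chi> i j. cnj (A $ j $ i))"

definition unitary :: "complex^'m^'m \<Rightarrow> bool"
  where "unitary Q \<longleftrightarrow> Q ** conj_transpose Q = mat 1"

definition diag_matrix :: "('m \<Rightarrow> complex) \<Rightarrow> complex^'m^'m"
  where "diag_matrix d = (\<chi> i j. if i = j then d i else 0)"

definition random_unitary :: "'w measure \<Rightarrow> ('w \<Rightarrow> complex^'m^'m) \<Rightarrow> bool"
  where "random_unitary M Q \<longleftrightarrow> Q \<in> borel_measurable M \<and> (\<forall>\<omega>\<in>space M. unitary (Q \<omega>))"

text \<open>Only the marginal laws of the diagonal entries are prescribed; their joint law is arbitrary.\<close>

definition random_diagonal ::
    "'w measure \<Rightarrow> ('m \<Rightarrow> complex measure) \<Rightarrow> ('w \<Rightarrow> complex^'m^'m) \<Rightarrow> bool"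
  where "random_diagonal M p L \<longleftrightarrow>
    (\<exists>l. (\<forall>\<omega>\<in>space M. L \<omega> = diag_matrix (\<lambda>j. l j \<omega>)) \<and> (\<forall>j. has_law M (l j) (p j)))"

end

theory Submission
  imports Defs
begin

text \<open>Since \<open>A\<close> is unitary, cyclicity of the trace reduces \<open>tr (A (A B)\<^sup>\<dagger>)\<close> to the conjugate of
  \<open>tr B\<close>. Each term of \<open>tr B\<close> is a diagonal entry of \<open>Q\<^sub>2\<close> times an independent phase of mean zero.\<close>

lemma conj_transpose_mult: "conj_transpose (A ** B) = conj_transpose B ** conj_transpose A"
  by (simp add: conj_transpose_def matrix_matrix_mult_def vec_eq_iff mult.commute)

lemma trace_conj_transpose: "trace (conj_transpose A) = cnj (trace A)"
  by (simp add: trace_def conj_transpose_def)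

text \<open>The definition of \<open>unitary\<close> provides a right inverse; for square matrices
  it is also a left inverse. This is the form needed once cyclicity has moved \<open>A\<close> to
  the right of its conjugate transpose.\<close>

lemma unitary_left: "unitary A \<Longrightarrow> conj_transpose A ** A = mat 1"
  by (simp add: unitary_def matrix_left_right_inverse)

lemma unitary_mult:
  assumes "unitary A" "unitary B"
  shows "unitary (A ** B)"
proof -
  have "(A ** B) ** conj_transpose (A ** B) = A ** (B ** conj_transpose B) ** conj_transpose A"
    by (simp add: conj_transpose_mult matrix_mul_assoc)
  then show ?thesis
    using assms by (simp add: unitary_def)
qed

lemma unitary_diag_matrix:
  assumes "\<And>j. cmod (d j) = 1"
  shows "unitary (diag_matrix d)"
proof -
  have "d j * cnj (d j) = 1" for j
    using complex_norm_square[of "d j"] assms[of j] by simp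
  then show ?thesis
    \<comment> \<open>Pushing \<open>cnj\<close> and the products into the conditionals leaves sums
      with a single nonzero term, which simp collapses.\<close>
    by (simp add: unitary_def diag_matrix_def conj_transpose_def matrix_matrix_mult_def mat_def
        vec_eq_iff if_distrib[of cnj] if_distrib[of "\<lambda>x. x * _"] if_distrib[of "\<lambda>x. _ * x"]
        cong: if_cong)
qed

text \<open>Every row of a unitary matrix has Euclidean norm 1, and one squared modulus is at most
  the sum of all. The bound serves to make the entries of a random unitary matrix
  integrable.\<close>

lemma unitary_entry_le_1:
  assumes "unitary Q"
  shows "cmod (Q $ i $ j) \<le> 1"
proof -
  have "(\<Sum>k\<in>UNIV. Q $ i $ k * cnj (Q $ i $ k)) = 1"
    using assms by (simp add: unitary_def conj_transpose_def matrix_matrix_mult_def mat_def vec_eq_iff)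
  then have "complex_of_real (\<Sum>k\<in>UNIV. (cmod (Q $ i $ k))\<^sup>2) = 1"
    by (simp add: complex_norm_square del: of_real_power)
  then have "(\<Sum>k\<in>UNIV. (cmod (Q $ i $ k))\<^sup>2) = 1"
    using of_real_eq_1_iff by blast
  moreover have "(cmod (Q $ i $ j))\<^sup>2 \<le> (\<Sum>k\<in>UNIV. (cmod (Q $ i $ k))\<^sup>2)"
    by (rule member_le_sum) auto
  ultimately show ?thesis
    by (simp add: power_le_one_iff)
qed

lemma trace_mult_conj_transpose_unitary:
  assumes "unitary A"
  shows "trace (A ** conj_transpose (A ** B)) = cnj (trace B)"
proof -
  have "trace (A ** conj_transpose (A ** B)) = trace ((conj_transpose B ** conj_transpose A) ** A)"
    by (simp add: conj_transpose_mult trace_mul_sym[of A])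
  also have "\<dots> = trace (conj_transpose B)"
    using assms by (simp add: matrix_mul_assoc[symmetric] unitary_left)
  finally show ?thesis
    by (simp add: trace_conj_transpose)
qed

lemma trace_mult_diag_matrix: "trace (Q ** diag_matrix d) = (\<Sum>j\<in>UNIV. Q $ j $ j * d j)"
  by (simp add: trace_def diag_matrix_def matrix_matrix_mult_def if_distrib[of "\<lambda>x. _ * x"]
      cong: if_cong)

text \<open>This holds at every point, not just almost everywhere: measurability sends
  \<open>space M\<close> into \<open>space p\<close>, and equality of the sigma-algebras forces
  \<open>space p = U1\<close>.\<close>

lemma has_law_norm:
  assumes "distribution_on_U1 p" "has_law M X p" "\<omega> \<in> space M"
  shows "cmod (X \<omega>) = 1"
proof -
  have "space p = U1"
    using assms(1) sets_eq_imp_space_eq[of p "restrict_space borel U1"]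
    by (simp add: distribution_on_U1_def space_restrict_space)
  moreover have "X \<omega> \<in> space p"
    using assms(2,3) measurable_space by (auto simp: has_law_def)
  ultimately show ?thesis
    by (simp add: U1_def)
qed

text \<open>Change of variables along \<open>X\<close>, applied to the identity integrand on
  \<open>p\<close>.\<close>

lemma has_law_mean_0:
  assumes "has_law M X p" "zero_mean p"
  shows "integrable M X" "(\<integral>\<omega>. X \<omega> \<partial>M) = 0"
proof -
  have X: "X \<in> M \<rightarrow>\<^sub>M p" and distr: "distr M p X = p"
    using assms(1) by (auto simp: has_law_def)
  have int: "integrable p (\<lambda>z. z)" and mean: "(\<integral>z. z \<partial>p) = 0"
    using assms(2) by (auto simp: zero_mean_def)
  show "integrable M X"
    using integrable_distr[OF X, of "\<lambda>z. z"] int distr by simp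
  show "(\<integral>\<omega>. X \<omega> \<partial>M) = 0"
    using integral_distr[OF X, of "\<lambda>z. z"] int mean distr by simp
qed

lemma random_diagonal_unitary:
  assumes "\<And>j. distribution_on_U1 (p j)" "random_diagonal M p L" "\<omega> \<in> space M"
  shows "unitary (L \<omega>)"
proof -
  obtain l where L: "L \<omega> = diag_matrix (\<lambda>j. l j \<omega>)" and law: "\<And>j. has_law M (l j) (p j)"
    using assms(2,3) by (auto simp: random_diagonal_def)
  show ?thesis
    unfolding L using has_law_norm[OF assms(1) law assms(3)] by (rule unitary_diag_matrix)
qed

text \<open>The trace is a sum over \<open>j\<close>, so linearity lets each \<open>j\<close> be
  treated alone: only the marginal law of each phase enters, and each product has expectation
  E[Q_jj] * 0.\<close>

lemma (in prob_space) expectation_trace_unitary_diagonal: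
  fixes Q L :: "'a \<Rightarrow> complex^'m^'m"
  assumes zero: "\<And>j. zero_mean (p j)"
    and Q: "random_unitary M Q"
    and L: "random_diagonal M p L"
    and indep: "indep_var borel Q borel L"
  shows "integrable M (\<lambda>\<omega>. trace (Q \<omega> ** L \<omega>))"
    and "expectation (\<lambda>\<omega>. trace (Q \<omega> ** L \<omega>)) = 0"
proof -
  obtain l where l: "\<And>\<omega>. \<omega> \<in> space M \<Longrightarrow> L \<omega> = diag_matrix (\<lambda>j. l j \<omega>)"
    and law: "\<And>j. has_law M (l j) (p j)"
    using L by (auto simp: random_diagonal_def)
  have entry[measurable]: "(\<lambda>X. X $ j $ j) \<in> borel_measurable (borel :: (complex^'m^'m) measure)" for j
    by (intro borel_measurable_continuous_onI continuous_intros)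
  have Q_meas[measurable]: "Q \<in> borel_measurable M"
    using Q by (simp add: random_unitary_def)
  \<comment> \<open>Independence is known for the matrix \<open>L\<close>, the laws for the
    functions \<open>l j\<close>. The two agree on \<open>space M\<close>, which is enough to
    transfer integrals.\<close>
  have Ljj: "L \<omega> $ j $ j = l j \<omega>" if "\<omega> \<in> space M" for \<omega> j
    using l[OF that] by (simp add: diag_matrix_def)
  have QL_indep: "indep_var borel (\<lambda>\<omega>. Q \<omega> $ j $ j) borel (\<lambda>\<omega>. L \<omega> $ j $ j)" for j
    using indep_var_compose[OF indep entry[of j] entry[of j]] by (simp add: comp_def)
  \<comment> \<open>The product rule for independent variables asks for integrable factors; a
    bounded measurable function on a probability space is integrable.\<close>
  have Q_int: "integrable M (\<lambda>\<omega>. Q \<omega> $ j $ j)" for j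
  proof (rule integrable_const_bound)
    show "AE \<omega> in M. cmod (Q \<omega> $ j $ j) \<le> 1"
      using Q by (auto simp: random_unitary_def intro!: AE_I2 unitary_entry_le_1)
  qed measurable
  have L_int: "integrable M (\<lambda>\<omega>. L \<omega> $ j $ j)" and L_mean: "expectation (\<lambda>\<omega>. L \<omega> $ j $ j) = 0" for j
    using has_law_mean_0[OF law zero, of j]
    by (simp_all add: Ljj cong: Bochner_Integration.integrable_cong Bochner_Integration.integral_cong)
  have prod_int: "integrable M (\<lambda>\<omega>. Q \<omega> $ j $ j * L \<omega> $ j $ j)" for j
    by (rule indep_var_integrable[OF QL_indep Q_int L_int])
  have prod_mean: "expectation (\<lambda>\<omega>. Q \<omega> $ j $ j * L \<omega> $ j $ j) = 0" for j
    by (simp add: indep_var_lebesgue_integral[OF QL_indep Q_int L_int] L_mean)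
  have tr: "trace (Q \<omega> ** L \<omega>) = (\<Sum>j\<in>UNIV. Q \<omega> $ j $ j * L \<omega> $ j $ j)" if "\<omega> \<in> space M" for \<omega>
    \<comment> \<open>\<open>diag_matrix\<close> is unfolded only in the second simp, so that
      \<open>trace_mult_diag_matrix\<close> can still match in the first.\<close>
    by (simp add: l[OF that] trace_mult_diag_matrix) (simp add: diag_matrix_def)
  show "integrable M (\<lambda>\<omega>. trace (Q \<omega> ** L \<omega>))"
    by (subst Bochner_Integration.integrable_cong[OF refl tr]) (auto intro: prod_int)
  show "expectation (\<lambda>\<omega>. trace (Q \<omega> ** L \<omega>)) = 0"
    by (subst Bochner_Integration.integral_cong[OF refl tr])
      (auto simp: Bochner_Integration.integral_sum prod_int prod_mean)
qed

theorem corollary3: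
  fixes M :: "'w measure"
    and p :: "'m::finite \<Rightarrow> complex measure"
    and Q1 Q2 L1 L2 A B :: "'w \<Rightarrow> complex^'m^'m"
  assumes "prob_space M"
    and "\<And>j. distribution_on_U1 (p j)"
    and "\<And>j. symmetric_distribution (p j)"
    and "\<And>j. zero_mean (p j)"
    and "random_unitary M Q1"
    and "random_unitary M Q2"
    and "random_diagonal M p L1"
    and "random_diagonal M p L2"
    and "prob_space.indep_var M borel Q1 borel L1"
    and "prob_space.indep_var M borel Q2 borel L2"
    and "prob_space.indep_var M
           (borel \<Otimes>\<^sub>M borel) (\<lambda>\<omega>. (Q1 \<omega>, L1 \<omega>))
           (borel \<Otimes>\<^sub>M borel) (\<lambda>\<omega>. (Q2 \<omega>, L2 \<omega>))"
    and "\<And>\<omega>. \<omega> \<in> space M \<Longrightarrow> A \<omega> = Q1 \<omega> ** L1 \<omega>"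
    and "\<And>\<omega>. \<omega> \<in> space M \<Longrightarrow> B \<omega> = Q2 \<omega> ** L2 \<omega>"
  shows "integrable M (\<lambda>\<omega>. trace (A \<omega> ** conj_transpose (A \<omega> ** B \<omega>))) \<and>
    prob_space.expectation M (\<lambda>\<omega>. trace (A \<omega> ** conj_transpose (A \<omega> ** B \<omega>))) = 0"
proof -
  interpret prob_space M by fact
  have tr: "trace (A \<omega> ** conj_transpose (A \<omega> ** B \<omega>)) = cnj (trace (Q2 \<omega> ** L2 \<omega>))"
    if \<omega>: "\<omega> \<in> space M" for \<omega>
  proof -
    have "unitary (Q1 \<omega>)"
      using assms(5) \<omega> by (simp add: random_unitary_def)
    \<comment> \<open>The diagonal entries of \<open>L1\<close> have modulus 1 at every point, so
      \<open>A\<close> is a product of two unitary matrices.\<close>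
    then have "unitary (A \<omega>)"
      using unitary_mult random_diagonal_unitary[OF assms(2,7) \<omega>] assms(12)[OF \<omega>] by simp
    then show ?thesis
      by (simp add: trace_mult_conj_transpose_unitary assms(13)[OF \<omega>])
  qed
  note mean = expectation_trace_unitary_diagonal[OF assms(4,6,8,10)]
  show ?thesis
    \<comment> \<open>Conjugation commutes with the integral, so integrability and zero mean pass
      from the trace of \<open>B\<close> to its conjugate.\<close>
    using mean
    by (simp add: tr cong: Bochner_Integration.integrable_cong Bochner_Integration.integral_cong)
qed

end
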